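(* Let $f:L\to L'$ be a homomorphism of bounded distributive lattices. The Stone dual of $f$ preserves closed sets if and only if for every prime ideal $P$ of $L$ and for every ideal $I$ of $L'$ we have $$P\supseteq f^{-1}(I)\ \Rightarrow\ P=f^{-1}(Q)\ \text{for some prime ideal } Q \text{ of } L' \text{ with } Q\supseteq I.$$
   Context: The Stone dual of a bounded distributive lattice $L$ is $\mathrm{Spec}(L)$, the set of prime ideals of $L$ with the topology generated by the open sets $\{P : a\notin P\}$, $a\in L$. The Stone dual of a lattice homomorphism $f:L\to L'$ (preserving $0$ and $1$) is the map $f^{-1}:\mathrm{Spec}(L')\to\mathrm{Spec}(L)$. A map preserves closed sets if the image of every closed set is closed. *)

theory Defs
  imports "HOL-Analysis.Analysis"
begin

definition bdd_lattice_hom ::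
    "('a::{bounded_lattice,distrib_lattice} \<Rightarrow> 'b::{bounded_lattice,distrib_lattice}) \<Rightarrow> bool"
  where "bdd_lattice_hom f \<longleftrightarrow>
    f bot = bot \<and> f top = top \<and>
    (\<forall>x y. f (sup x y) = sup (f x) (f y)) \<and> (\<forall>x y. f (inf x y) = inf (f x) (f y))"

(* The whole lattice counts as an ideal; the empty set does not. *)
definition lattice_ideal :: "'a::{bounded_lattice,distrib_lattice} set \<Rightarrow> bool"
  where "lattice_ideal I \<longleftrightarrow>
    I \<noteq> {} \<and> (\<forall>x\<in>I. \<forall>y. y \<le> x \<longrightarrow> y \<in> I) \<and> (\<forall>x\<in>I. \<forall>y\<in>I. sup x y \<in> I)"

definition prime_lattice_ideal :: "'a::{bounded_lattice,distrib_lattice} set \<Rightarrow> bool"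
  where "prime_lattice_ideal P \<longleftrightarrow>
    lattice_ideal P \<and> P \<noteq> UNIV \<and> (\<forall>x y. inf x y \<in> P \<longrightarrow> x \<in> P \<or> y \<in> P)"

definition Spec_topology :: "'a::{bounded_lattice,distrib_lattice} set topology"
  where "Spec_topology =
    topology_generated_by (range (\<lambda>a. {P. prime_lattice_ideal P \<and> a \<notin> P}))"

(* The underlying set is the spectrum: a prime ideal omits top. *)
lemma topspace_Spec_topology:
  "topspace Spec_topology = {P::'a::{bounded_lattice,distrib_lattice} set. prime_lattice_ideal P}"
proof -
  have "top \<notin> P" if "prime_lattice_ideal P" for P :: "'a set"
    using that top_greatest unfolding prime_lattice_ideal_def lattice_ideal_def by blast
  then show ?thesis
    unfolding Spec_topology_def topology_generated_by_topspace by blast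
qed

definition stone_dual ::
    "('a::{bounded_lattice,distrib_lattice} \<Rightarrow> 'b::{bounded_lattice,distrib_lattice}) \<Rightarrow>
     'b set \<Rightarrow> 'a set"
  where "stone_dual f Q = f -` Q"

lemma stone_dual_in_Spec:
  assumes "bdd_lattice_hom f" and "prime_lattice_ideal Q"
  shows "prime_lattice_ideal (stone_dual f Q)"
proof -
  have sup: "f (sup x y) = sup (f x) (f y)" and inf: "f (inf x y) = inf (f x) (f y)"
    and bt: "f bot = bot" "f top = top" for x y
    using assms(1) unfolding bdd_lattice_hom_def by auto
  have mono: "f x \<le> f y" if "x \<le> y" for x y
    using sup[of x y] that by (metis sup.absorb_iff2)
  have Q: "bot \<in> Q" "top \<notin> Q"
    using assms(2) bot_least top_greatest
    unfolding prime_lattice_ideal_def lattice_ideal_def by blast+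
  have "bot \<in> f -` Q" "top \<notin> f -` Q"
    using Q bt by auto
  then have "f -` Q \<noteq> {}" "f -` Q \<noteq> UNIV"
    by blast+
  then show ?thesis
    using assms(2) mono unfolding prime_lattice_ideal_def lattice_ideal_def stone_dual_def
    by (auto simp: sup inf)
qed

end

theory Submission
  imports Defs
begin

text \<open>
  The closed subsets of a spectrum are exactly the hulls \<open>prime_hull S\<close>, and each is the hull of an
  ideal, namely of the intersection of its members. So the question is when the image under
  \<open>stone_dual f\<close> of the hull of an ideal \<open>I\<close> is again a hull. That image always lies in the hull of
  \<open>f -` I\<close>, and the condition of the theorem says precisely that the two are equal for every \<open>I\<close>;
  this yields preservation of closed sets at once.

  Conversely, suppose that the image is some hull \<open>prime_hull S\<close>. For \<open>a \<in> S\<close> every prime ideal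
  containing \<open>I\<close> contains \<open>f a\<close>. The prime ideal theorem (\<open>prime_ideal_theorem\<close>) then
  gives \<open>f a \<in> I\<close>, so \<open>S \<subseteq> f -` I\<close>, and every prime ideal above \<open>f -` I\<close> lies in
  \<open>prime_hull S\<close>, which is the image.
\<close>

definition prime_hull :: "'a::{bounded_lattice,distrib_lattice} set \<Rightarrow> 'a set set"
  where "prime_hull S = {P. prime_lattice_ideal P \<and> S \<subseteq> P}"

lemma lattice_ideal_Inter:
  assumes "\<And>J. J \<in> C \<Longrightarrow> lattice_ideal J"
  shows "lattice_ideal (\<Inter>C)"
proof -
  have "bot \<in> J" if "J \<in> C" for J
    using assms[OF that] bot_least unfolding lattice_ideal_def by blast
  then have "\<Inter>C \<noteq> {}"
    by blast
  then show ?thesis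
    using assms unfolding lattice_ideal_def by blast
qed

lemma lattice_ideal_Union_chain:
  assumes "C \<noteq> {}" and ideal: "\<And>J. J \<in> C \<Longrightarrow> lattice_ideal J"
    and chain: "\<And>J K. J \<in> C \<Longrightarrow> K \<in> C \<Longrightarrow> J \<subseteq> K \<or> K \<subseteq> J"
  shows "lattice_ideal (\<Union>C)"
  unfolding lattice_ideal_def
proof (intro conjI ballI allI impI)
  obtain J where "J \<in> C" "J \<noteq> {}"
    using assms(1) ideal unfolding lattice_ideal_def by fastforce
  then show "\<Union>C \<noteq> {}"
    by blast
next
  fix x y assume "x \<in> \<Union>C" "y \<le> x"
  then show "y \<in> \<Union>C"
    using ideal unfolding lattice_ideal_def by blast
next
  fix x y assume "x \<in> \<Union>C" "y \<in> \<Union>C"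
  then obtain J K where "J \<in> C" "x \<in> J" "K \<in> C" "y \<in> K"
    by blast
  moreover from this have "J \<subseteq> K \<or> K \<subseteq> J"
    using chain by blast
  ultimately obtain M where "M \<in> C" "x \<in> M" "y \<in> M"
    by blast
  then show "sup x y \<in> \<Union>C"
    using ideal unfolding lattice_ideal_def by blast
qed

text \<open>The ideal generated by \<open>M\<close> and \<open>x\<close>.\<close>

lemma lattice_ideal_adjoin:
  assumes "lattice_ideal M"
  shows "lattice_ideal {z. \<exists>m\<in>M. z \<le> sup m x}"
  unfolding lattice_ideal_def
proof (intro conjI ballI allI impI)
  obtain m where "m \<in> M"
    using assms unfolding lattice_ideal_def by fastforce
  then show "{z. \<exists>m\<in>M. z \<le> sup m x} \<noteq> {}"
    using sup_ge1 by blast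
next
  fix u v assume "u \<in> {z. \<exists>m\<in>M. z \<le> sup m x}" "v \<le> u"
  then show "v \<in> {z. \<exists>m\<in>M. z \<le> sup m x}"
    using order_trans by blast
next
  fix u v assume "u \<in> {z. \<exists>m\<in>M. z \<le> sup m x}" "v \<in> {z. \<exists>m\<in>M. z \<le> sup m x}"
  then obtain m n where mn: "m \<in> M" "u \<le> sup m x" "n \<in> M" "v \<le> sup n x"
    by blast
  have "sup u v \<le> sup (sup m x) (sup n x)"
    using mn by (intro sup_mono)
  also have "\<dots> = sup (sup m n) x"
    by (simp add: ac_simps)
  finally show "sup u v \<in> {z. \<exists>m\<in>M. z \<le> sup m x}"
    using mn assms unfolding lattice_ideal_def by blast
qed

text \<open>
  An ideal \<open>M\<close> that is maximal among those avoiding \<open>a\<close> is prime: if neither \<open>x\<close> nor \<open>y\<close> is in \<open>M\<close>,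
  then adjoining either one captures \<open>a\<close>, so \<open>a \<le> sup k x\<close> and \<open>a \<le> sup k y\<close> for some \<open>k \<in> M\<close>.
  By distributivity \<open>a \<le> sup k (inf x y)\<close>, hence \<open>inf x y \<notin> M\<close>.
\<close>

lemma maximal_avoiding_ideal_is_prime:
  assumes M: "lattice_ideal M" "a \<notin> M"
    and max: "\<And>J. lattice_ideal J \<Longrightarrow> M \<subseteq> J \<Longrightarrow> a \<notin> J \<Longrightarrow> J = M"
  shows "prime_lattice_ideal M"
proof -
  have capture: "\<exists>m\<in>M. a \<le> sup m x" if "x \<notin> M" for x
  proof (rule ccontr)
    assume no: "\<not> (\<exists>m\<in>M. a \<le> sup m x)"
    let ?J = "{z. \<exists>m\<in>M. z \<le> sup m x}"
    have "M \<subseteq> ?J"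
      using sup_ge1 by blast
    with no have "?J = M"
      using max[OF lattice_ideal_adjoin[OF M(1)]] by blast
    moreover have "x \<in> ?J"
      using M(1) sup_ge2 unfolding lattice_ideal_def by blast
    ultimately show False
      using that by blast
  qed
  have "x \<in> M \<or> y \<in> M" if xy: "inf x y \<in> M" for x y
  proof (rule ccontr)
    assume "\<not> (x \<in> M \<or> y \<in> M)"
    then obtain m n where mn: "m \<in> M" "a \<le> sup m x" "n \<in> M" "a \<le> sup n y"
      using capture by blast
    have "sup m x \<le> sup (sup m n) x" "sup n y \<le> sup (sup m n) y"
      by (simp_all add: le_supI1)
    then have "a \<le> inf (sup (sup m n) x) (sup (sup m n) y)"
      using mn order_trans by (metis le_inf_iff)
    also have "\<dots> = sup (sup m n) (inf x y)"
      by (simp add: sup_inf_distrib1)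
    finally have "a \<le> sup (sup m n) (inf x y)" .
    moreover have "sup (sup m n) (inf x y) \<in> M"
      using M(1) mn xy unfolding lattice_ideal_def by blast
    ultimately show False
      using M unfolding lattice_ideal_def by blast
  qed
  then show ?thesis
    using M unfolding prime_lattice_ideal_def by blast
qed

text \<open>
  Zorn's lemma provides the maximal ideal needed for \<open>maximal_avoiding_ideal_is_prime\<close>.
\<close>

theorem prime_ideal_theorem:
  assumes I: "lattice_ideal I" "a \<notin> I"
  obtains Q where "prime_lattice_ideal Q" "I \<subseteq> Q" "a \<notin> Q"
proof -
  let ?A = "{J. lattice_ideal J \<and> I \<subseteq> J \<and> a \<notin> J}"
  have "\<exists>M\<in>?A. \<forall>J\<in>?A. M \<subseteq> J \<longrightarrow> J = M"
  proof (rule subset_Zorn_nonempty)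
    show "?A \<noteq> {}"
      using I by blast
  next
    fix C assume C: "C \<noteq> {}" "subset.chain ?A C"
    then have "\<And>J K. J \<in> C \<Longrightarrow> K \<in> C \<Longrightarrow> J \<subseteq> K \<or> K \<subseteq> J"
      unfolding subset_chain_def by blast
    moreover have "C \<subseteq> ?A"
      using C unfolding subset_chain_def by blast
    ultimately have "lattice_ideal (\<Union>C)"
      using C(1) by (intro lattice_ideal_Union_chain) blast+
    then show "\<Union>C \<in> ?A"
      using \<open>C \<subseteq> ?A\<close> C(1) by blast
  qed
  then obtain M where M: "lattice_ideal M" "I \<subseteq> M" "a \<notin> M"
    and max: "\<forall>J\<in>?A. M \<subseteq> J \<longrightarrow> J = M"
    by blast
  have "prime_lattice_ideal M"
    by (rule maximal_avoiding_ideal_is_prime[OF M(1,3)]) (use max M(2) in blast)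
  then show ?thesis
    using that M by blast
qed

text \<open>
  The generating sets are already a base: they are closed under finite intersections, because a
  prime ideal omitting \<open>a\<close> and \<open>b\<close> omits \<open>inf a b\<close>.
\<close>

lemma openin_Spec_basic_neighbourhood:
  assumes "openin Spec_topology U" "P \<in> U"
  obtains a where "a \<notin> P" "{Q. prime_lattice_ideal Q \<and> a \<notin> Q} \<subseteq> U"
proof -
  have prime: "prime_lattice_ideal P"
    using openin_subset[OF assms(1)] assms(2) topspace_Spec_topology by blast
  have "generate_topology_on (range (\<lambda>a. {P. prime_lattice_ideal P \<and> a \<notin> P})) U"
    using assms(1) unfolding Spec_topology_def openin_topology_generated_by_iff .
  then have "\<exists>a. a \<notin> P \<and> {Q. prime_lattice_ideal Q \<and> a \<notin> Q} \<subseteq> U"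
    using assms(2)
  proof (induction rule: generate_topology_on.induct)
    case Empty
    then show ?case by blast
  next
    case (Int U V)
    then obtain a b where ab: "a \<notin> P" "b \<notin> P"
      "{Q. prime_lattice_ideal Q \<and> a \<notin> Q} \<subseteq> U" "{Q. prime_lattice_ideal Q \<and> b \<notin> Q} \<subseteq> V"
      by blast
    have "inf a b \<notin> P"
      using prime ab unfolding prime_lattice_ideal_def by blast
    moreover have "a \<notin> Q \<and> b \<notin> Q" if "prime_lattice_ideal Q" "inf a b \<notin> Q" for Q
      using that inf_le1[of a b] inf_le2[of a b]
      unfolding prime_lattice_ideal_def lattice_ideal_def by blast
    ultimately show ?case
      using ab by blast
  next
    case (UN K)
    then show ?case by blast
  next
    case (Basis U)
    then show ?case by blast
  qed
  then show ?thesis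
    using that by blast
qed

lemma closedin_prime_hull: "closedin Spec_topology (prime_hull S)"
proof -
  have "openin Spec_topology (\<Union>a\<in>S. {P. prime_lattice_ideal P \<and> a \<notin> P})"
    unfolding Spec_topology_def by (intro openin_Union) (auto intro: topology_generated_by_Basis)
  moreover have "topspace Spec_topology - prime_hull S
      = (\<Union>a\<in>S. {P. prime_lattice_ideal P \<and> a \<notin> P})"
    unfolding topspace_Spec_topology prime_hull_def by blast
  ultimately show ?thesis
    unfolding closedin_def by (auto simp: topspace_Spec_topology prime_hull_def)
qed

text \<open>
  A prime ideal \<open>P\<close> outside \<open>C\<close> has a basic neighbourhood, given by some \<open>a \<notin> P\<close>, that misses \<open>C\<close>.
  Missing \<open>C\<close> means that \<open>a\<close> lies in every member of \<open>C\<close>, so \<open>P\<close> does not contain \<open>\<Inter>C\<close>.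
\<close>

lemma closedin_Spec_eq_prime_hull_Inter:
  assumes "closedin Spec_topology C"
  shows "C = prime_hull (\<Inter>C)"
proof
  show "C \<subseteq> prime_hull (\<Inter>C)"
    using closedin_subset[OF assms] unfolding topspace_Spec_topology prime_hull_def by blast
next
  show "prime_hull (\<Inter>C) \<subseteq> C"
  proof (rule subsetI, rule ccontr)
    fix P assume P: "P \<in> prime_hull (\<Inter>C)" "P \<notin> C"
    then have "P \<in> topspace Spec_topology - C"
      unfolding topspace_Spec_topology prime_hull_def by blast
    moreover have "openin Spec_topology (topspace Spec_topology - C)"
      using assms by blast
    ultimately obtain a where "a \<notin> P"
      "{Q. prime_lattice_ideal Q \<and> a \<notin> Q} \<subseteq> topspace Spec_topology - C"
      using openin_Spec_basic_neighbourhood by blast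
    moreover from this have "a \<in> \<Inter>C"
      using closedin_subset[OF assms] unfolding topspace_Spec_topology by blast
    ultimately show False
      using P unfolding prime_hull_def by blast
  qed
qed

theorem lemma5p13:
  fixes f :: "'a::{bounded_lattice,distrib_lattice} \<Rightarrow> 'b::{bounded_lattice,distrib_lattice}"
  assumes "bdd_lattice_hom f"
  shows "closed_map Spec_topology Spec_topology (stone_dual f) \<longleftrightarrow>
    (\<forall>P I. prime_lattice_ideal P \<longrightarrow> lattice_ideal I \<longrightarrow> f -` I \<subseteq> P \<longrightarrow>
      (\<exists>Q. prime_lattice_ideal Q \<and> I \<subseteq> Q \<and> P = f -` Q))"
    (is "?closed \<longleftrightarrow> ?lifting")
proof
  assume closed: ?closed
  show ?lifting
  proof (intro allI impI)
    fix P I assume P: "prime_lattice_ideal P" "f -` I \<subseteq> P" and I: "lattice_ideal I"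
    let ?S = "\<Inter>(stone_dual f ` prime_hull I)"
    have image: "stone_dual f ` prime_hull I = prime_hull ?S"
      using closed closedin_prime_hull
      by (intro closedin_Spec_eq_prime_hull_Inter) (auto simp: closed_map_def)
    have "?S \<subseteq> f -` I"
    proof
      fix a assume a: "a \<in> ?S"
      have "f a \<in> I"
      proof (rule ccontr)
        assume "f a \<notin> I"
        with I obtain Q where "prime_lattice_ideal Q" "I \<subseteq> Q" "f a \<notin> Q"
          using prime_ideal_theorem by blast
        then show False
          using a unfolding prime_hull_def stone_dual_def by blast
      qed
      then show "a \<in> f -` I"
        by simp
    qed
    with P have "P \<in> prime_hull ?S"
      unfolding prime_hull_def by blast
    then have "P \<in> stone_dual f ` prime_hull I"
      using image by simp
    then show "\<exists>Q. prime_lattice_ideal Q \<and> I \<subseteq> Q \<and> P = f -` Q"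
      unfolding prime_hull_def stone_dual_def by blast
  qed
next
  assume lifting: ?lifting
  have "closedin Spec_topology (stone_dual f ` C)" if C: "closedin Spec_topology C" for C
  proof -
    have hull: "C = prime_hull (\<Inter>C)"
      by (rule closedin_Spec_eq_prime_hull_Inter[OF C])
    have "\<And>J. J \<in> C \<Longrightarrow> lattice_ideal J"
      using closedin_subset[OF C] unfolding topspace_Spec_topology prime_lattice_ideal_def by blast
    then have ideal: "lattice_ideal (\<Inter>C)"
      by (rule lattice_ideal_Inter)
    have "stone_dual f ` prime_hull (\<Inter>C) = prime_hull (f -` \<Inter>C)"
    proof
      show "stone_dual f ` prime_hull (\<Inter>C) \<subseteq> prime_hull (f -` \<Inter>C)"
        using stone_dual_in_Spec[OF assms] unfolding prime_hull_def stone_dual_def by blast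
    next
      show "prime_hull (f -` \<Inter>C) \<subseteq> stone_dual f ` prime_hull (\<Inter>C)"
      proof
        fix P assume "P \<in> prime_hull (f -` \<Inter>C)"
        then have "prime_lattice_ideal P" "f -` \<Inter>C \<subseteq> P"
          unfolding prime_hull_def by simp_all
        then obtain Q where Q: "prime_lattice_ideal Q" "\<Inter>C \<subseteq> Q" "P = f -` Q"
          using lifting[rule_format, of P "\<Inter>C", OF _ ideal] by metis
        show "P \<in> stone_dual f ` prime_hull (\<Inter>C)"
          by (rule image_eqI[of _ _ Q])
            (simp_all only: Q stone_dual_def prime_hull_def mem_Collect_eq simp_thms)
      qed
    qed
    then have "stone_dual f ` C = prime_hull (f -` \<Inter>C)"
      by (subst hull)
    then show ?thesis
      by (simp only: closedin_prime_hull)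
  qed
  then show ?closed
    unfolding closed_map_def by blast
qed

end
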